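(* Let $\mathcal{J}$ be the monoid of all bijections $\mathbb{N}\to\mathbb{N}$ under composition, regarded as a category with exactly one object $\mathbb{N}$. Let $\star$ be the operation on $\mathcal{J}$, and $\tau,\sigma\in\mathcal{J}$ the bijections, defined in the context, where $\star$ acts on objects by $\mathbb{N}\star\mathbb{N}=\mathbb{N}$, and $\tau$ and $\sigma$ are taken as the unique components $\tau_{\mathbb{N},\mathbb{N},\mathbb{N}}$ and $\sigma_{\mathbb{N},\mathbb{N}}$ of the associativity and symmetry families. Then $(\mathcal{J},\star,\tau,\sigma)$ is an untyped symmetric monoidal category, i.e. a symmetric semi-monoidal category with exactly one object.
   Context: Here $\mathbb{N}=\{0,1,2,\dots\}$, and composition is written by juxtaposition, with $(hf)(n)=h(f(n))$. The bijections $\tau,\sigma:\mathbb{N}\to\mathbb{N}$ are $$\tau(n)=\begin{cases}2n & n \bmod 2=0,\\ n+1 & n\bmod 4=1,\\ \frac{n-1}{2} & n\bmod 4=3,\end{cases}\qquad \sigma(n)=\begin{cases}n+1 & n\text{ even},\\ n-1 & n\text{ odd}.\end{cases}$$ For bijections $f,g:\mathbb{N}\to\mathbb{N}$, the bijection $f\star g$ is $$(f\star g)(n)=\begin{cases}2f\left(\frac n2\right) & n\text{ even},\\ 2g\left(\frac{n-1}{2}\right)+1 & n\text{ odd}.\end{cases}$$ A category $\mathcal{C}$ is semi-monoidal when it satisfies all the properties of a monoidal category except for the requirement of a unit object. That is, there is a functor (tensor) $\Box:\mathcal{C}\times\mathcal{C}\to\mathcal{C}$ together with a family of isomorphisms $\tau_{A,B,C}:A\Box(B\Box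 C)\to(A\Box B)\Box C$, natural in the objects $A,B,C$, satisfying MacLane's pentagon condition $$(\tau_{A,B,C}\Box 1_D)\,\tau_{A,B\Box C,D}\,(1_A\Box\tau_{B,C,D})=\tau_{A\Box B,C,D}\,\tau_{A,B,C\Box D}.$$ It is a symmetric semi-monoidal category when there is also a family of isomorphisms $\sigma_{X,Y}:X\Box Y\to Y\Box X$, natural in the objects $X,Y$, satisfying MacLane's hexagon condition $$\tau_{C,A,B}\,\sigma_{A\Box B,C}\,\tau_{A,B,C}=(\sigma_{A,C}\Box 1_B)\,\tau_{A,C,B}\,(1_A\Box\sigma_{B,C}).$$ A semi-monoidal category with only one object is called untyped monoidal (or untyped); in particular no unit object is required. *)

theory Defs
  imports Main
begin

section \<open>Categories and functors\<close>

record ('o, 'a) cat =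
  Ob :: "'o set"
  Arr :: "'a set"
  Dom :: "'a \<Rightarrow> 'o"
  Cod :: "'a \<Rightarrow> 'o"
  Id :: "'o \<Rightarrow> 'a"
  Comp :: "'a \<Rightarrow> 'a \<Rightarrow> 'a"  (infixr \<open>\<cdot>\<index>\<close> 75)

text \<open>Composition is in applicative order: \<open>g \<cdot> f\<close> is ``first \<open>f\<close>, then \<open>g\<close>''. It is meaningful
  only if the codomain of \<open>f\<close> is the domain of \<open>g\<close>.\<close>

definition hom :: "('o, 'a) cat \<Rightarrow> 'o \<Rightarrow> 'o \<Rightarrow> 'a set" where
  "hom C A B = {f \<in> Arr C. Dom C f = A \<and> Cod C f = B}"

locale category =
  fixes C :: "('o, 'a) cat" (structure)
  assumes dom_in_Ob: "f \<in> Arr C \<Longrightarrow> Dom C f \<in> Ob C"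
    and cod_in_Ob: "f \<in> Arr C \<Longrightarrow> Cod C f \<in> Ob C"
    and id_in_hom: "A \<in> Ob C \<Longrightarrow> Id C A \<in> hom C A A"
    and comp_in_hom: "\<lbrakk>f \<in> hom C X Y; g \<in> hom C Y Z\<rbrakk> \<Longrightarrow> g \<cdot> f \<in> hom C X Z"
    and comp_id_right: "f \<in> hom C X Y \<Longrightarrow> f \<cdot> Id C X = f"
    and comp_id_left: "f \<in> hom C X Y \<Longrightarrow> Id C Y \<cdot> f = f"
    and comp_assoc: "\<lbrakk>f \<in> hom C W X; g \<in> hom C X Y; h \<in> hom C Y Z\<rbrakk>
      \<Longrightarrow> (h \<cdot> g) \<cdot> f = h \<cdot> (g \<cdot> f)"

definition is_iso :: "('o, 'a) cat \<Rightarrow> 'o \<Rightarrow> 'o \<Rightarrow> 'a \<Rightarrow> bool" where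
  "is_iso C A B f \<longleftrightarrow> f \<in> hom C A B \<and>
     (\<exists>g \<in> hom C B A. Comp C g f = Id C A \<and> Comp C f g = Id C B)"

definition prod_cat :: "('o, 'a) cat \<Rightarrow> ('p, 'b) cat \<Rightarrow> ('o \<times> 'p, 'a \<times> 'b) cat" where
  "prod_cat C D =
     \<lparr>Ob = Ob C \<times> Ob D,
      Arr = Arr C \<times> Arr D,
      Dom = map_prod (Dom C) (Dom D),
      Cod = map_prod (Cod C) (Cod D),
      Id = map_prod (Id C) (Id D),
      Comp = (\<lambda>(g, g') (f, f'). (Comp C g f, Comp D g' f'))\<rparr>"

locale covariant_functor = source: category C + target: category D
  for C :: "('o, 'a) cat" and D :: "('p, 'b) cat" +
  fixes FO :: "'o \<Rightarrow> 'p" and FA :: "'a \<Rightarrow> 'b"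
  assumes map_Ob: "A \<in> Ob C \<Longrightarrow> FO A \<in> Ob D"
    and map_hom: "f \<in> hom C A B \<Longrightarrow> FA f \<in> hom D (FO A) (FO B)"
    and map_id: "A \<in> Ob C \<Longrightarrow> FA (Id C A) = Id D (FO A)"
    and map_comp: "\<lbrakk>f \<in> hom C X Y; g \<in> hom C Y Z\<rbrakk>
      \<Longrightarrow> FA (Comp C g f) = Comp D (FA g) (FA f)"


section \<open>Semi-monoidal categories\<close>

text \<open>The tensor has an object part \<open>\<boxtimes>\<close> and an arrow part \<open>\<box>\<close>.\<close>

locale semi_monoidal_category = category C
  for C :: "('o, 'a) cat" (structure) +
  fixes tensor_ob :: "'o \<Rightarrow> 'o \<Rightarrow> 'o"  (infixr \<open>\<boxtimes>\<close> 80)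
    and tensor_arr :: "'a \<Rightarrow> 'a \<Rightarrow> 'a"  (infixr \<open>\<box>\<close> 80)
    and assoc :: "'o \<Rightarrow> 'o \<Rightarrow> 'o \<Rightarrow> 'a"
  assumes tensor_functor:
      "covariant_functor (prod_cat C C) C (\<lambda>(A, B). A \<boxtimes> B) (\<lambda>(f, g). f \<box> g)"
    and assoc_iso: "\<lbrakk>X \<in> Ob C; Y \<in> Ob C; Z \<in> Ob C\<rbrakk>
      \<Longrightarrow> is_iso C (X \<boxtimes> (Y \<boxtimes> Z)) ((X \<boxtimes> Y) \<boxtimes> Z) (assoc X Y Z)"
    and assoc_natural: "\<lbrakk>f \<in> hom C X X'; g \<in> hom C Y Y'; h \<in> hom C Z Z'\<rbrakk>
      \<Longrightarrow> assoc X' Y' Z' \<cdot> (f \<box> (g \<box> h)) = ((f \<box> g) \<box> h) \<cdot> assoc X Y Z"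
    and pentagon: "\<lbrakk>W \<in> Ob C; X \<in> Ob C; Y \<in> Ob C; Z \<in> Ob C\<rbrakk>
      \<Longrightarrow> (assoc W X Y \<box> Id C Z) \<cdot> assoc W (X \<boxtimes> Y) Z \<cdot> (Id C W \<box> assoc X Y Z)
        = assoc (W \<boxtimes> X) Y Z \<cdot> assoc W X (Y \<boxtimes> Z)"

locale symmetric_semi_monoidal_category =
  semi_monoidal_category C tensor_ob tensor_arr assoc
  for C :: "('o, 'a) cat" (structure)
    and tensor_ob (infixr \<open>\<boxtimes>\<close> 80)
    and tensor_arr (infixr \<open>\<box>\<close> 80)
    and assoc +
  fixes sym :: "'o \<Rightarrow> 'o \<Rightarrow> 'a"
  assumes sym_iso: "\<lbrakk>X \<in> Ob C; Y \<in> Ob C\<rbrakk> \<Longrightarrow> is_iso C (X \<boxtimes> Y) (Y \<boxtimes> X) (sym X Y)"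
    and sym_natural: "\<lbrakk>f \<in> hom C X X'; g \<in> hom C Y Y'\<rbrakk>
      \<Longrightarrow> sym X' Y' \<cdot> (f \<box> g) = (g \<box> f) \<cdot> sym X Y"
    and hexagon: "\<lbrakk>X \<in> Ob C; Y \<in> Ob C; Z \<in> Ob C\<rbrakk>
      \<Longrightarrow> assoc Z X Y \<cdot> sym (X \<boxtimes> Y) Z \<cdot> assoc X Y Z
        = (sym X Z \<box> Id C Y) \<cdot> assoc X Z Y \<cdot> (Id C X \<box> sym Y Z)"

locale untyped_symmetric_monoidal_category =
  symmetric_semi_monoidal_category C tensor_ob tensor_arr assoc sym
  for C :: "('o, 'a) cat" (structure) and tensor_ob and tensor_arr and assoc and sym +
  assumes one_object: "\<exists>!A. A \<in> Ob C"


section \<open>The category of bijections of the natural numbers\<close>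

text \<open>The unique object is the set of natural numbers itself.\<close>

definition J :: "(nat set, nat \<Rightarrow> nat) cat" where
  "J = \<lparr>Ob = {UNIV}, Arr = {f. bij f}, Dom = (\<lambda>_. UNIV), Cod = (\<lambda>_. UNIV),
        Id = (\<lambda>_. id), Comp = (\<circ>)\<rparr>"

definition star :: "(nat \<Rightarrow> nat) \<Rightarrow> (nat \<Rightarrow> nat) \<Rightarrow> nat \<Rightarrow> nat"  (infixr \<open>\<star>\<close> 80) where
  "(f \<star> g) n = (if even n then 2 * f (n div 2) else 2 * g ((n - 1) div 2) + 1)"

definition star_ob :: "nat set \<Rightarrow> nat set \<Rightarrow> nat set" where
  "star_ob A B = UNIV"

definition \<tau> :: "nat \<Rightarrow> nat" where
  "\<tau> n = (if n mod 2 = 0 then 2 * n else if n mod 4 = 1 then n + 1 else (n - 1) div 2)"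

definition \<sigma> :: "nat \<Rightarrow> nat" where
  "\<sigma> n = (if even n then n + 1 else n - 1)"

end

theory Submission
  imports Defs
begin

text \<open>The maps \<open>n \<mapsto> 2n\<close> and \<open>n \<mapsto> 2n + 1\<close> exhibit the natural numbers as the disjoint union of two
  copies of themselves. Under this identification \<open>\<star>\<close>, \<open>\<tau>\<close> and \<open>\<sigma>\<close> are the disjoint union of
  functions with its canonical associativity and symmetry maps, so each coherence condition can be
  checked separately on the words in the two injections.\<close>

definition inj_even :: "nat \<Rightarrow> nat" where
  "inj_even n = 2 * n"

definition inj_odd :: "nat \<Rightarrow> nat" where
  "inj_odd n = 2 * n + 1"

lemma even_odd_cases [case_names even odd]:
  obtains m where "n = inj_even m" | m where "n = inj_odd m"
  by (metis evenE inj_even_def inj_odd_def oddE)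

text \<open>The universal property of the disjoint union: a map is determined by its composites with
  the two injections.\<close>

lemma fun_eq_even_oddI:
  assumes "\<And>n. f (inj_even n) = g (inj_even n)" and "\<And>n. f (inj_odd n) = g (inj_odd n)"
  shows "f = g"
proof
  fix n
  show "f n = g n"
    by (cases n rule: even_odd_cases) (simp_all add: assms)
qed

lemma star_apply [simp]:
  "(f \<star> g) (inj_even n) = inj_even (f n)"
  "(f \<star> g) (inj_odd n) = inj_odd (g n)"
  by (simp_all add: star_def inj_even_def inj_odd_def)

lemma \<sigma>_apply [simp]:
  "\<sigma> (inj_even n) = inj_odd n"
  "\<sigma> (inj_odd n) = inj_even n"
  by (simp_all add: \<sigma>_def inj_even_def inj_odd_def)

text \<open>This is the re-bracketing of \<open>A + (B + C)\<close> as \<open>(A + B) + C\<close>: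
  the words on the left name its three summands before the move, those on the right after
  it.\<close>

lemma \<tau>_apply [simp]:
  "\<tau> (inj_even n) = inj_even (inj_even n)"
  "\<tau> (inj_odd (inj_even n)) = inj_even (inj_odd n)"
  "\<tau> (inj_odd (inj_odd n)) = inj_odd n"
proof -
  show "\<tau> (inj_even n) = inj_even (inj_even n)"
    by (simp add: \<tau>_def inj_even_def)
  \<comment> \<open>The residues select the branch of \<open>\<tau>\<close>: here the argument has
    the form \<open>4 * k + 1\<close>, in the last case \<open>4 * k + 3\<close>.\<close>
  have "(2 * (2 * n) + 1) mod 2 = 1" "(2 * (2 * n) + 1) mod 4 = 1"
    by presburger+
  then show "\<tau> (inj_odd (inj_even n)) = inj_even (inj_odd n)"
    by (simp add: \<tau>_def inj_even_def inj_odd_def)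
  have "(2 * (2 * n + 1) + 1) mod 2 = 1" "(2 * (2 * n + 1) + 1) mod 4 = 3"
    by presburger+
  then show "\<tau> (inj_odd (inj_odd n)) = inj_odd n"
    by (simp add: \<tau>_def inj_odd_def)
qed

lemma star_id: "id \<star> id = id"
  by (rule fun_eq_even_oddI) simp_all

lemma star_comp: "(g \<circ> f) \<star> (g' \<circ> f') = (g \<star> g') \<circ> (f \<star> f')"
  by (rule fun_eq_even_oddI) simp_all

lemma bij_star:
  assumes "bij f" and "bij g"
  shows "bij (f \<star> g)"
proof (rule o_bij)
  \<comment> \<open>Functoriality supplies the inverse: \<open>star_comp\<close> read backwards
    merges each composite into \<open>id \<star> id\<close>.\<close>
  show "(inv f \<star> inv g) \<circ> (f \<star> g) = id" "(f \<star> g) \<circ> (inv f \<star> inv g) = id"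
    using assms
    by (simp_all add: bij_is_inj bij_is_surj surj_iff[THEN iffD1] star_id flip: star_comp)
qed

lemma \<sigma>_\<sigma>: "\<sigma> \<circ> \<sigma> = id"
  by (rule fun_eq_even_oddI) simp_all

lemma bij_\<sigma>: "bij \<sigma>"
  using \<sigma>_\<sigma> by (rule o_bij) (rule \<sigma>_\<sigma>)

lemma \<sigma>_natural: "\<sigma> \<circ> (f \<star> g) = (g \<star> f) \<circ> \<sigma>"
  by (rule fun_eq_even_oddI) simp_all

lemma \<tau>_natural: "\<tau> \<circ> (f \<star> (g \<star> h)) = ((f \<star> g) \<star> h) \<circ> \<tau>"
proof (rule fun_eq_even_oddI)
  fix n
  show "(\<tau> \<circ> (f \<star> (g \<star> h))) (inj_odd n) = (((f \<star> g) \<star> h) \<circ> \<tau>) (inj_odd n)"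
    \<comment> \<open>After an odd outermost letter \<open>\<tau>\<close> also reads the next one,
      so this branch is split once more.\<close>
    by (cases n rule: even_odd_cases) simp_all
qed simp

lemma inj_even_odd_eq_iff [simp]:
  "inj_even m = inj_even n \<longleftrightarrow> m = n"
  "inj_odd m = inj_odd n \<longleftrightarrow> m = n"
  "inj_even m \<noteq> inj_odd n"
  "inj_odd m \<noteq> inj_even n"
  unfolding inj_even_def inj_odd_def by presburger+

text \<open>The ranges of the three source words in \<open>\<tau>_apply\<close> partition the
  naturals, and so do those of the three target words; \<open>\<tau>\<close> matches the pieces one
  to one.\<close>

lemma bij_\<tau>: "bij \<tau>"
proof (rule bijI)
  show "inj \<tau>"
  proof (rule injI)
    fix m n
    assume "\<tau> m = \<tau> n"
    then show "m = n"
      by (cases m rule: even_odd_cases; cases n rule: even_odd_cases; simp;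
          metis even_odd_cases \<tau>_apply inj_even_odd_eq_iff)
  qed
  have "n \<in> range \<tau>" for n
    by (metis even_odd_cases \<tau>_apply rangeI)
  then show "surj \<tau>"
    by blast
qed

text \<open>Four summands are involved. Writing \<open>e\<close> and \<open>o\<close> for the
  injections, outermost first, both sides send the words \<open>e\<close>, \<open>oe\<close>,
  \<open>ooe\<close>, \<open>ooo\<close> to \<open>eee\<close>, \<open>eeo\<close>,
  \<open>eo\<close>, \<open>o\<close>.\<close>

lemma pentagon_\<tau>: "(\<tau> \<star> id) \<circ> \<tau> \<circ> (id \<star> \<tau>) = \<tau> \<circ> \<tau>"
proof (rule fun_eq_even_oddI)
  fix n
  show "((\<tau> \<star> id) \<circ> \<tau> \<circ> (id \<star> \<tau>)) (inj_odd n) = (\<tau> \<circ> \<tau>) (inj_odd n)"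
  proof (cases n rule: even_odd_cases)
    case (odd m)
    then show ?thesis
      by (cases m rule: even_odd_cases) simp_all
  qed simp
qed simp

text \<open>Both sides rotate three summands: in the same notation \<open>e\<close>,
  \<open>oe\<close>, \<open>oo\<close> go to \<open>eo\<close>, \<open>o\<close>,
  \<open>ee\<close>.\<close>

lemma hexagon_\<tau>_\<sigma>: "\<tau> \<circ> \<sigma> \<circ> \<tau> = (\<sigma> \<star> id) \<circ> \<tau> \<circ> (id \<star> \<sigma>)"
proof (rule fun_eq_even_oddI)
  fix n
  show "(\<tau> \<circ> \<sigma> \<circ> \<tau>) (inj_odd n) = ((\<sigma> \<star> id) \<circ> \<tau> \<circ> (id \<star> \<sigma>)) (inj_odd n)"
    by (cases n rule: even_odd_cases) simp_all
qed simp

lemma hom_J [simp]: "f \<in> hom J A B \<longleftrightarrow> bij f \<and> A = UNIV \<and> B = UNIV"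
  by (auto simp: hom_def J_def)

lemma J_simps [simp]: "Ob J = {UNIV}" "Arr J = {f. bij f}" "Dom J f = UNIV" "Cod J f = UNIV"
    "Id J A = id" "Comp J g f = g \<circ> f"
  by (simp_all add: J_def)

text \<open>The inverse of a bijection is again an arrow of \<open>J\<close>, so the isomorphism
  conditions on \<open>\<tau>\<close> and \<open>\<sigma>\<close> reduce to bijectivity.\<close>

lemma is_iso_J [simp]: "is_iso J A B f \<longleftrightarrow> bij f \<and> A = UNIV \<and> B = UNIV"
proof -
  have "\<exists>g. bij g \<and> g \<circ> f = id \<and> f \<circ> g = id" if "bij f"
    using that by (intro exI[of _ "inv f"])
      (simp add: bij_imp_bij_inv bij_is_inj bij_is_surj surj_iff[THEN iffD1])
  then show ?thesis
    by (auto simp: is_iso_def Bex_def)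
qed

lemma category_J: "category J"
  by standard (simp_all add: bij_comp comp_assoc)

lemma hom_prod_cat:
  "f \<in> hom (prod_cat C D) A B \<longleftrightarrow>
    fst f \<in> hom C (fst A) (fst B) \<and> snd f \<in> hom D (snd A) (snd B)"
  by (cases f; cases A; cases B) (auto simp: hom_def prod_cat_def)

lemma prod_cat_simps [simp]:
  "Ob (prod_cat C D) = Ob C \<times> Ob D"
  "Arr (prod_cat C D) = Arr C \<times> Arr D"
  "Dom (prod_cat C D) f = (Dom C (fst f), Dom D (snd f))"
  "Cod (prod_cat C D) f = (Cod C (fst f), Cod D (snd f))"
  "Id (prod_cat C D) A = (Id C (fst A), Id D (snd A))"
  "Comp (prod_cat C D) g f = (Comp C (fst g) (fst f), Comp D (snd g) (snd f))"
  by (simp_all add: prod_cat_def map_prod_def split_beta)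

lemma category_prod_cat:
  assumes "category C" and "category D"
  shows "category (prod_cat C D)"
proof -
  interpret C: category C by fact
  interpret D: category D by fact
  show ?thesis
    by standard
      (auto simp: hom_prod_cat C.dom_in_Ob D.dom_in_Ob C.cod_in_Ob D.cod_in_Ob
        C.id_in_hom D.id_in_hom C.comp_id_right D.comp_id_right C.comp_id_left D.comp_id_left
        C.comp_assoc D.comp_assoc intro: C.comp_in_hom D.comp_in_hom)
qed

lemma star_functor:
  "covariant_functor (prod_cat J J) J (\<lambda>(A, B). star_ob A B) (\<lambda>(f, g). f \<star> g)"
proof -
  interpret J: category J by (rule category_J)
  interpret JJ: category "prod_cat J J" by (intro category_prod_cat category_J)
  show ?thesis
    by standard
      (auto simp: hom_prod_cat star_ob_def bij_star star_id star_comp)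
qed

theorem theorem2p5:
  "untyped_symmetric_monoidal_category J star_ob (\<star>) (\<lambda>_ _ _. \<tau>) (\<lambda>_ _. \<sigma>)"
proof -
  \<comment> \<open>With this in place \<open>standard\<close> discharges the category axioms of
    \<open>J\<close> and the functoriality of the tensor.\<close>
  interpret covariant_functor "prod_cat J J" J "\<lambda>(A, B). star_ob A B" "\<lambda>(f, g). f \<star> g"
    by (rule star_functor)
  show ?thesis
    by standard
      \<comment> \<open>The locale axioms nest composites to the right, the two coherence lemmas to
        the left; \<open>Fun.comp_assoc\<close> reconciles them.\<close>
      (use pentagon_\<tau> hexagon_\<tau>_\<sigma> in
        \<open>simp_all add: star_ob_def bij_\<tau> bij_\<sigma> \<tau>_natural \<sigma>_natural Fun.comp_assoc\<close>)
qed

end
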